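(* Let $A\in\mathbb{R}^{m\times n}$, $b\in\mathbb{R}^m$, $G\in\mathbb{R}^{n\times n}$, and $P=\{x\in\mathbb{R}^n\mid Ax\le b\}$. Let $E\subseteq P$ be invariant with respect to $G$. Then, for any integer $r\ge 0$: (i) $I_r(E)\subseteq\mathcal{S}$; (ii) $I_r(E)\subseteq I_{r+1}(E)$; (iii) if $I_r(E)=I_{r+1}(E)$, then $I_k(E)=I_r(E)$ for all $k\ge r$.
   Context: Inequalities between vectors are entrywise. A set $E\subseteq\mathbb{R}^n$ is invariant with respect to $G$ if $x\in E$ implies $Gx\in E$. Define $\mathcal{S}:=\bigcap_{k=0}^{\infty}\{x\in\mathbb{R}^n \mid AG^kx\le b\}$, $S_r:=\bigcap_{k=0}^{r}\{x\in\mathbb{R}^n \mid AG^kx\le b\}$ for integers $r\ge0$, $S_{-1}:=\mathbb{R}^n$, and, for integers $r\ge 0$, $I_r(E):=S_{r-1}\cap\{x\in\mathbb{R}^n\mid G^rx\in E\}$ (so $I_0(E)=E$). *)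

theory Defs
  imports "HOL-Analysis.Analysis"
begin

text \<open>Vectors in n-space have type \<^typ>\<open>real ^ 'n\<close>, m-by-n matrices have type
  \<^typ>\<open>real ^ 'n ^ 'm\<close>. The library order on \<^typ>\<open>real ^ 'n\<close> is the entrywise one.\<close>

text \<open>The library's \<^term>\<open>(^)\<close> on matrices is the entrywise power, since \<^term>\<open>(*)\<close> is entrywise;
  the power with respect to the matrix product is needed here.\<close>

primrec mat_power :: "real ^ 'n ^ 'n \<Rightarrow> nat \<Rightarrow> real ^ 'n ^ 'n" where
  "mat_power G 0 = mat 1"
| "mat_power G (Suc k) = G ** mat_power G k"

definition polyhedron_of :: "real ^ 'n ^ 'm \<Rightarrow> real ^ 'm \<Rightarrow> (real ^ 'n) set" where
  "polyhedron_of A b = {x. A *v x \<le> b}"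

definition invariant_under :: "real ^ 'n ^ 'n \<Rightarrow> (real ^ 'n) set \<Rightarrow> bool" where
  "invariant_under G E \<longleftrightarrow> (\<forall>x\<in>E. G *v x \<in> E)"

definition S_inf :: "real ^ 'n ^ 'm \<Rightarrow> real ^ 'm \<Rightarrow> real ^ 'n ^ 'n \<Rightarrow> (real ^ 'n) set" where
  "S_inf A b G = (\<Inter>k. {x. (A ** mat_power G k) *v x \<le> b})"

text \<open>The index is an integer so that the value at -1, the empty intersection, is the whole space.\<close>

definition S_upto :: "real ^ 'n ^ 'm \<Rightarrow> real ^ 'm \<Rightarrow> real ^ 'n ^ 'n \<Rightarrow> int \<Rightarrow> (real ^ 'n) set" where
  "S_upto A b G r = (\<Inter>k\<in>{k. int k \<le> r}. {x. (A ** mat_power G k) *v x \<le> b})"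

definition I_set ::
  "real ^ 'n ^ 'm \<Rightarrow> real ^ 'm \<Rightarrow> real ^ 'n ^ 'n \<Rightarrow> nat \<Rightarrow> (real ^ 'n) set \<Rightarrow> (real ^ 'n) set" where
  "I_set A b G r E = S_upto A b G (int r - 1) \<inter> {x. mat_power G r *v x \<in> E}"

lemma S_upto_minus_one: "S_upto A b G (-1) = UNIV"
  by (simp add: S_upto_def)

lemma S_upto_of_nat: "S_upto A b G (int r) = (\<Inter>k\<in>{0..r}. {x. (A ** mat_power G k) *v x \<le> b})"
  by (auto simp: S_upto_def)

lemma I_set_0: "I_set A b G 0 E = E"
  by (simp add: I_set_def S_upto_def)

end

theory Submission
  imports Defs
begin

text \<open>Let \<open>P = {x. A x \<le> b}\<close> and consider the monotone operator \<open>T X = P \<inter> {x. G x \<in> X}\<close> on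
  subsets of n-space. Splitting off the first step of an orbit shows \<open>I\<^sub>r(E) = T\<^sup>r(E)\<close>
  (\<open>I_set_eq_funpow\<close>) and \<open>T \<S> = \<S>\<close> (\<open>S_inf_fixed_point\<close>).

  As \<open>E\<close> is invariant and lies in \<open>P\<close>, we have \<open>E \<subseteq> T E\<close> and \<open>E \<subseteq> \<S>\<close>. Applying \<open>T\<close>
  \<open>r\<close> times to these two inclusions gives \<open>I\<^sub>r(E) \<subseteq> I\<^sub>r\<^sub>+\<^sub>1(E)\<close> and \<open>I\<^sub>r(E) \<subseteq> \<S>\<close>. Finally, if
  \<open>I\<^sub>r(E) = I\<^sub>r\<^sub>+\<^sub>1(E)\<close>, then \<open>I\<^sub>r(E)\<close> is a fixed point of \<open>T\<close>, so further iteration does not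
  change it.\<close>

definition feasible_preimage ::
  "real ^ 'n ^ 'm \<Rightarrow> real ^ 'm \<Rightarrow> real ^ 'n ^ 'n \<Rightarrow> (real ^ 'n) set \<Rightarrow> (real ^ 'n) set" where
  "feasible_preimage A b G X = polyhedron_of A b \<inter> {x. G *v x \<in> X}"

lemma mono_feasible_preimage: "mono (feasible_preimage A b G)"
  by (auto simp: mono_def feasible_preimage_def)

text \<open>The definition of the matrix power puts the new factor on the left, so it extends an orbit at
  its end; the recursion for \<open>I_set\<close> removes a point from the start of the orbit instead.\<close>

lemma mat_power_Suc_vector: "mat_power G (Suc k) *v x = mat_power G k *v (G *v x)"
  by (induction k) (simp_all add: matrix_vector_mul_assoc [symmetric])

lemma mem_S_inf_iff: "x \<in> S_inf A b G \<longleftrightarrow> (\<forall>k. A *v (mat_power G k *v x) \<le> b)"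
  by (simp add: S_inf_def matrix_vector_mul_assoc)

lemma mem_I_set_iff:
  "x \<in> I_set A b G r E \<longleftrightarrow> (\<forall>k<r. A *v (mat_power G k *v x) \<le> b) \<and> mat_power G r *v x \<in> E"
  by (auto simp: I_set_def S_upto_def matrix_vector_mul_assoc)

lemma I_set_Suc: "I_set A b G (Suc r) E = feasible_preimage A b G (I_set A b G r E)"
  by (simp add: set_eq_iff mem_I_set_iff feasible_preimage_def polyhedron_of_def
      All_less_Suc2 mat_power_Suc_vector del: mat_power.simps(2))

lemma I_set_eq_funpow: "I_set A b G r E = (feasible_preimage A b G ^^ r) E"
  by (induction r) (simp_all add: I_set_0 I_set_Suc)

lemma S_inf_fixed_point: "feasible_preimage A b G (S_inf A b G) = S_inf A b G"
proof (rule set_eqI)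
  fix x
  have "(\<forall>k. A *v (mat_power G k *v x) \<le> b) \<longleftrightarrow>
      A *v x \<le> b \<and> (\<forall>k. A *v (mat_power G k *v (G *v x)) \<le> b)"
    by (metis mat_power.simps(1) mat_power_Suc_vector matrix_vector_mul_lid not0_implies_Suc)
  then show "x \<in> feasible_preimage A b G (S_inf A b G) \<longleftrightarrow> x \<in> S_inf A b G"
    unfolding feasible_preimage_def polyhedron_of_def mem_S_inf_iff by blast
qed

lemma invariant_under_mat_power:
  assumes "invariant_under G E" and "x \<in> E"
  shows "mat_power G k *v x \<in> E"
  using assms
  by (induction k) (simp_all add: invariant_under_def matrix_vector_mul_assoc [symmetric])

lemma invariant_subset_S_inf:
  assumes "E \<subseteq> polyhedron_of A b" and "invariant_under G E"
  shows "E \<subseteq> S_inf A b G"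
proof
  fix x
  assume "x \<in> E"
  then have "mat_power G k *v x \<in> polyhedron_of A b" for k
    using invariant_under_mat_power [OF assms(2)] assms(1) by blast
  then show "x \<in> S_inf A b G"
    by (simp add: mem_S_inf_iff polyhedron_of_def)
qed

lemma invariant_subset_feasible_preimage:
  assumes "E \<subseteq> polyhedron_of A b" and "invariant_under G E"
  shows "E \<subseteq> feasible_preimage A b G E"
  using assms by (auto simp: feasible_preimage_def invariant_under_def)

theorem lemma2p8:
  fixes A :: "real ^ 'n ^ 'm" and b :: "real ^ 'm" and G :: "real ^ 'n ^ 'n"
    and E :: "(real ^ 'n) set" and r :: nat
  assumes "E \<subseteq> polyhedron_of A b"
    and "invariant_under G E"
  shows "I_set A b G r E \<subseteq> S_inf A b G
    \<and> I_set A b G r E \<subseteq> I_set A b G (r + 1) E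
    \<and> (I_set A b G r E = I_set A b G (r + 1) E
        \<longrightarrow> (\<forall>k\<ge>r. I_set A b G k E = I_set A b G r E))"
proof (intro conjI impI allI)
  let ?T = "feasible_preimage A b G"
  have mono_iterate: "(?T ^^ r) X \<subseteq> (?T ^^ r) Y" if "X \<subseteq> Y" for X Y
    using mono_pow [OF mono_feasible_preimage] that by (rule monoD)
  have "(?T ^^ r) (S_inf A b G) = S_inf A b G"
    by (induction r) (simp_all add: S_inf_fixed_point)
  then show "I_set A b G r E \<subseteq> S_inf A b G"
    using mono_iterate [OF invariant_subset_S_inf [OF assms]] by (simp add: I_set_eq_funpow)
  show "I_set A b G r E \<subseteq> I_set A b G (r + 1) E"
    using mono_iterate [OF invariant_subset_feasible_preimage [OF assms]]
    by (simp add: I_set_eq_funpow funpow_swap1)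
next
  fix k
  assume stationary: "I_set A b G r E = I_set A b G (r + 1) E" and "r \<le> k"
  from \<open>r \<le> k\<close> show "I_set A b G k E = I_set A b G r E"
  proof (induction k rule: dec_induct)
    case base
    show ?case by simp
  next
    case (step k)
    have "I_set A b G (Suc k) E = feasible_preimage A b G (I_set A b G r E)"
      using step.IH by (simp add: I_set_Suc)
    also have "\<dots> = I_set A b G (r + 1) E"
      by (simp add: I_set_Suc)
    also have "\<dots> = I_set A b G r E"
      by (rule stationary [symmetric])
    finally show ?case .
  qed
qed

end
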